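(* Let $0<x<1$ be real. Then $$\frac{Z_3(x)}{\Delta_3(x)}=\frac{\theta_4(0,x^3)}{\theta_4(0,x)}=\sum_{n\ge0}a(n)x^n,$$ where $a(n)$ is the number of partitions of $2n$ into parts not divisible by $3$ in which every odd part occurs with even multiplicity (with no restriction on the multiplicities of the even parts).
   Context: Here $Z_3(x)=\prod_{k\ge1}(1+x^k+x^{2k})$ is the parafermionic partition function of order $3$ and $\Delta_3(x)=\prod_{k\ge1}(1-x^k+x^{2k})$ is the graded parafermionic partition function of order $3$. In the physical setting $x=e^{-\beta\omega}$ with $\beta,\omega>0$. The Jacobi theta function is $\theta_4(0,x)=\sum_{n=-\infty}^{\infty}(-1)^n x^{n^2}$. An odd part not appearing in the partition counts as having multiplicity $0$, which is even. The empty partition is the unique partition of $0$. *)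

theory Defs
  imports "HOL-Analysis.Analysis" "HOL-Library.Multiset"
begin

(* prodinf indexes its factors from 0, so the factor for k >= 1 sits at index k - 1. *)

definition Z3 :: "real \<Rightarrow> real" where
  "Z3 x = (\<Prod>k. 1 + x ^ Suc k + x ^ (2 * Suc k))"

definition Delta3 :: "real \<Rightarrow> real" where
  "Delta3 x = (\<Prod>k. 1 - x ^ Suc k + x ^ (2 * Suc k))"

definition theta4_0 :: "real \<Rightarrow> real" where
  "theta4_0 x = (\<Sum>\<^sub>\<infinity>n\<in>(UNIV :: int set). (-1) powi n * x powi (n\<^sup>2))"

definition partitions :: "nat \<Rightarrow> nat multiset set" where
  "partitions m = {P. (\<forall>p\<in>#P. p > 0) \<and> sum_mset P = m}"

definition a_count :: "nat \<Rightarrow> nat" where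
  "a_count n = card {P \<in> partitions (2 * n).
     (\<forall>p\<in>#P. \<not> 3 dvd p) \<and> (\<forall>p. odd p \<longrightarrow> even (count P p))}"

(* The lemmas below show that no default value (of prodinf, infsum or card) is involved in
   the definitions above. *)

lemma Z3_convergent:
  fixes x :: real
  assumes "0 < x" "x < 1"
  shows "convergent_prod (\<lambda>k. 1 + x ^ Suc k + x ^ (2 * Suc k))"
proof -
  have "summable (\<lambda>k. x * x ^ k + x\<^sup>2 * (x\<^sup>2) ^ k)"
    using assms by (intro summable_add summable_mult summable_geometric) (auto simp: power_less_one_iff)
  then have "summable (\<lambda>k. norm (1 + x ^ Suc k + x ^ (2 * Suc k) - 1))"
    by (rule summable_comparison_test'[where N = 0])
      (use assms in \<open>simp add: power_mult power_add power2_eq_square power_mult_distrib\<close>)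
  then show ?thesis
    by (intro abs_convergent_prod_imp_convergent_prod summable_imp_abs_convergent_prod)
qed

lemma Delta3_convergent:
  fixes x :: real
  assumes "0 < x" "x < 1"
  shows "convergent_prod (\<lambda>k. 1 - x ^ Suc k + x ^ (2 * Suc k))"
proof -
  have "summable (\<lambda>k. x * x ^ k + x\<^sup>2 * (x\<^sup>2) ^ k)"
    using assms by (intro summable_add summable_mult summable_geometric) (auto simp: power_less_one_iff)
  moreover have "norm (norm (1 - x ^ Suc k + x ^ (2 * Suc k) - 1)) \<le> x * x ^ k + x\<^sup>2 * (x\<^sup>2) ^ k" for k
  proof -
    have "x ^ (2 * Suc k) = x\<^sup>2 * (x\<^sup>2) ^ k"
      by (metis power_Suc power_mult)
    moreover have "x * x ^ k > 0" "x\<^sup>2 * (x\<^sup>2) ^ k > 0" using assms by simp_all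
    ultimately show ?thesis by simp
  qed
  ultimately have "summable (\<lambda>k. norm (1 - x ^ Suc k + x ^ (2 * Suc k) - 1))"
    by (rule summable_comparison_test'[where N = 0])
  then show ?thesis
    by (intro abs_convergent_prod_imp_convergent_prod summable_imp_abs_convergent_prod)
qed

lemma Delta3_nonzero:
  fixes x :: real
  assumes "0 < x" "x < 1"
  shows "Delta3 x \<noteq> 0"
proof -
  have "1 - x ^ Suc k + x ^ (2 * Suc k) \<noteq> 0" for k
  proof -
    have "x ^ Suc k < 1" using power_Suc_less_one[OF assms] .
    moreover have "x ^ (2 * Suc k) > 0" using assms by simp
    ultimately show ?thesis by linarith
  qed
  then show ?thesis
    unfolding Delta3_def by (intro prodinf_nonzero Delta3_convergent assms) 
qed

lemma theta4_0_summable: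
  fixes x :: real
  assumes "0 < x" "x < 1"
  shows "(\<lambda>n. (-1) powi n * x powi (n\<^sup>2)) summable_on (UNIV :: int set)"
proof -
  have bound: "norm ((-1) powi n * x powi (n\<^sup>2)) \<le> x ^ nat \<bar>n\<bar>" for n :: int
  proof -
    have "norm ((-1) powi n * x powi (n\<^sup>2)) = x ^ nat (n\<^sup>2)"
      using assms by (cases "n \<ge> 0") (simp_all add: power_int_def abs_mult power_abs)
    also have "\<bar>n\<bar> \<le> n\<^sup>2"
    proof (cases "n = 0")
      case False
      then have "\<bar>n\<bar> * 1 \<le> \<bar>n\<bar> * \<bar>n\<bar>"
        by (intro mult_left_mono) linarith+
      then show ?thesis by (simp add: power2_eq_square)
    qed simp
    then have "x ^ nat (n\<^sup>2) \<le> x ^ nat \<bar>n\<bar>"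
      using assms by (intro power_decreasing) auto
    finally show ?thesis .
  qed
  have geo: "(\<lambda>k. x ^ k) summable_on (UNIV :: nat set)"
    by (rule norm_summable_imp_summable_on) (use assms in \<open>simp add: summable_geometric\<close>)
  have "(\<lambda>n. x ^ nat \<bar>n\<bar>) summable_on range int"
    using geo by (subst summable_on_reindex) (auto simp: o_def)
  moreover have "(\<lambda>n. x ^ nat \<bar>n\<bar>) summable_on range (\<lambda>k. - int k)"
    using geo by (subst summable_on_reindex) (auto simp: o_def inj_on_def)
  ultimately have "(\<lambda>n. x ^ nat \<bar>n\<bar>) summable_on (range int \<union> range (\<lambda>k. - int k))"
    by (rule summable_on_union)
  moreover have "range int \<union> range (\<lambda>k. - int k) = UNIV"
  proof -
    have "n \<in> range int \<union> range (\<lambda>k. - int k)" for n :: int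
      by (cases n rule: int_cases2) simp_all
    then show ?thesis by blast
  qed
  ultimately have "(\<lambda>n. x ^ nat \<bar>n\<bar>) summable_on (UNIV :: int set)" by simp
  then have "(\<lambda>n. norm ((-1) powi n * x powi (n\<^sup>2))) summable_on (UNIV :: int set)"
    by (rule summable_on_comparison_test) (use bound in auto)
  then show ?thesis by (rule abs_summable_summable)
qed

lemma finite_partitions: "finite (partitions m)"
proof -
  have "P \<in> (\<Union>k\<le>m. {P. set_mset P \<subseteq> {..m} \<and> size P = k})" if "P \<in> partitions m" for P
  proof -
    have "size P \<le> sum_mset P" if "\<forall>p\<in>#P. p > 0" for P :: "nat multiset"
      using that by (induction P) (auto simp: Suc_le_eq add_mono)
    then show ?thesis
      using that by (auto simp: partitions_def dest: multi_member_split)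
  qed
  then have "partitions m \<subseteq> (\<Union>k\<le>m. {P. set_mset P \<subseteq> {..m} \<and> size P = k})" by blast
  moreover have "finite {P :: nat multiset. set_mset P \<subseteq> {..m} \<and> size P = k}" for k
    using finite_multisets_of_size[of "{..m}" k] by (simp add: multisets_of_size_def)
  then have "finite (\<Union>k\<le>m. {P :: nat multiset. set_mset P \<subseteq> {..m} \<and> size P = k})"
    by (simp del: UN_simps)
  ultimately show ?thesis by (rule finite_subset)
qed

end

theory Submission
  imports Defs
begin

text \<open>
  Since \<open>1 + t + t\<^sup>2\<close> and \<open>1 - t + t\<^sup>2\<close> are quotients of \<open>1 - t\<^sup>3\<close> by \<open>1 - t\<close> and of \<open>1 + t\<^sup>3\<close>
  by \<open>1 + t\<close>, the ratio of the partition functions reduces to Gauss's product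
  \<open>\<theta>\<^sub>4(0, q) = \<Prod> (1 - q\<^sup>k) / (1 + q\<^sup>k)\<close>. The product is obtained without the Jacobi triple product,
  as the limit of an exact finite identity proved by telescoping.

  For the series, weight each part \<open>p\<close> by \<open>x\<close> to the power \<open>p / 2\<close>. Even parts \<open>2k\<close> then contribute
  \<open>1 / (1 - x\<^sup>k)\<close> and the pairs of an odd part \<open>p\<close> contribute \<open>1 / (1 - x\<^sup>p)\<close>; Euler's
  \<open>\<Prod> 1 / (1 - x\<^sup>p) = \<Prod> (1 + x\<^sup>k)\<close> (\<open>p\<close> odd) turns the total into the product of
  \<open>(1 + x\<^sup>k) / (1 - x\<^sup>k)\<close> over all \<open>k\<close> not divisible by \<open>3\<close>.
\<close>

section \<open>A finite form of Gauss's product for theta_4\<close>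

definition gauss_prod :: "real \<Rightarrow> nat \<Rightarrow> real" where
  "gauss_prod q n = (\<Prod>k\<in>{1..n}. (1 - q ^ k) / (1 + q ^ k))"

text \<open>These are the coefficients \<open>(-1; q)_j / (q; q)_j\<close> of the q-binomial series
  F(z) = (-z; q)_inf / (z; q)_inf. At z = -q^(n+1), F(z) is the tail of Gauss's product that
  \<open>gauss_prod q n\<close> leaves out.\<close>

definition gauss_coeff :: "real \<Rightarrow> nat \<Rightarrow> real" where
  "gauss_coeff q j = (\<Prod>i<j. (1 + q ^ i) / (1 - q ^ Suc i))"

lemma gauss_prod_Suc: "gauss_prod q (Suc n) = gauss_prod q n * ((1 - q ^ Suc n) / (1 + q ^ Suc n))"
  by (simp add: gauss_prod_def)

lemma gauss_coeff_Suc: "gauss_coeff q (Suc j) = gauss_coeff q j * ((1 + q ^ j) / (1 - q ^ Suc j))"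
  by (simp add: gauss_coeff_def)

text \<open>Everything cancels except the factor 1 + q^0 = 2 of \<open>gauss_coeff\<close>. This is
  where the 2 in front of the theta sum comes from.\<close>

lemma gauss_prod_coeff:
  assumes "0 < q" "q < 1"
  shows "gauss_prod q n * gauss_coeff q (Suc n) * (1 - q ^ Suc n) = 2"
proof (induction n)
  case 0
  then show ?case using assms by (simp add: gauss_prod_def gauss_coeff_def divide_simps)
next
  case (Suc n)
  have *: "1 - q ^ Suc n \<noteq> 0" "1 + q ^ Suc n \<noteq> 0" "1 - q ^ Suc (Suc n) \<noteq> 0"
    using assms power_Suc_less_one[of q] by (smt (verit) zero_less_power)+
  have "gauss_prod q (Suc n) * gauss_coeff q (Suc (Suc n)) * (1 - q ^ Suc (Suc n)) =
        gauss_prod q n * gauss_coeff q (Suc n) * (1 - q ^ Suc n)"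
    unfolding gauss_prod_Suc gauss_coeff_Suc[of q "Suc n"] using * by (simp add: divide_simps)
  then show ?case using Suc by simp
qed

text \<open>The q-binomial series satisfies (1 + z) F(q z) = (1 - z) F(z). At z = -q^n, cutting both
  series after m terms leaves a single boundary term.\<close>

lemma gauss_telescope:
  assumes "0 < q" "q < 1"
  shows "(1 - q ^ n) * (\<Sum>j<m. (- 1) ^ j * q ^ (j * Suc n) * gauss_coeff q j)
       - (1 + q ^ n) * (\<Sum>j<m. (- 1) ^ j * q ^ (j * n) * gauss_coeff q j)
       = (- 1) ^ m * q ^ (m * n) * gauss_coeff q m * (1 - q ^ m)"
proof (induction m)
  case (Suc m)
  have *: "1 - q ^ Suc m \<noteq> 0"
    using assms power_Suc_less_one[of q m] by linarith
  have "gauss_coeff q (Suc m) * (1 - q ^ Suc m) = gauss_coeff q m * (1 + q ^ m)"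
    using * by (simp add: gauss_coeff_Suc)
  then have R: "(- 1) ^ Suc m * q ^ (Suc m * n) * gauss_coeff q (Suc m) * (1 - q ^ Suc m)
       = (- 1) ^ Suc m * q ^ (Suc m * n) * (gauss_coeff q m * (1 + q ^ m))"
    by (metis mult.assoc)
  have e: "q ^ (Suc m * n) = q ^ n * q ^ (m * n)" "q ^ (m * Suc n) = q ^ m * q ^ (m * n)"
    by (simp_all add: power_add)
  \<comment> \<open>Here u, v, w, s, c stand for \<open>q ^ n\<close>, \<open>q ^ (m * n)\<close>,
    \<open>q ^ m\<close>, \<open>(- 1) ^ m\<close>, \<open>gauss_coeff q m\<close>, and B, A for the
    two partial sums.\<close>
  have alg: "(1 - u) * (B + s * (w * v) * c) - (1 + u) * (A + s * v * c) = - s * (u * v) * (c * (1 + w))"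
    if "(1 - u) * B - (1 + u) * A = s * v * c * (1 - w)" for u v w s c A B :: real
    using that by algebra
  show ?case
    unfolding R unfolding sum.lessThan_Suc e power_Suc[of "- 1"] mult_minus1 by (rule alg[OF Suc])
qed simp

text \<open>The identity behind Gauss's product for \<open>\<theta>\<^sub>4\<close>: the term \<open>j = 0\<close> on the right is the
  partial product, and the factors \<open>q ^ (j * Suc n)\<close> make the other terms negligible.\<close>

lemma gauss_finite_identity:
  assumes "0 < q" "q < 1"
  shows "1 + 2 * (\<Sum>k\<in>{1..n}. (- 1) ^ k * q ^ k\<^sup>2) =
    gauss_prod q n * (\<Sum>j<Suc n. (- 1) ^ j * q ^ (j * Suc n) * gauss_coeff q j)"
proof (induction n)
  case 0
  then show ?case by (simp add: gauss_prod_def gauss_coeff_def)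
next
  case (Suc n)
  define N where "N = Suc n"
  define A where "A = (\<Sum>j<N. (- 1) ^ j * q ^ (j * N) * gauss_coeff q j)"
  define B where "B = (\<Sum>j<N. (- 1) ^ j * q ^ (j * Suc N) * gauss_coeff q j)"
  have nz: "1 + q ^ N \<noteq> 0"
    using assms by (smt (verit) zero_less_power)
  have tel: "(1 - q ^ N) * B - (1 + q ^ N) * A = (- 1) ^ N * q ^ (N * N) * gauss_coeff q N * (1 - q ^ N)"
    unfolding A_def B_def using gauss_telescope[OF assms] .
  have c: "gauss_prod q n * gauss_coeff q N * (1 - q ^ N) = 2"
    unfolding N_def by (rule gauss_prod_coeff[OF assms])
  have p: "gauss_prod q N * (1 + q ^ N) = gauss_prod q n * (1 - q ^ N)"
    using nz unfolding N_def gauss_prod_Suc by simp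
  have e: "q ^ (N * Suc N) = q ^ N * q ^ (N * N)"
    by (simp add: power_add)
  \<comment> \<open>After scaling by 1 + q^N, \<open>p\<close> lowers the partial product to n and
    \<open>tel\<close> trades B for the A of the induction hypothesis. The boundary term of
    \<open>tel\<close> and the new summand share the factor 1 - q^N and add up to a multiple of 1 +
    q^N, which \<open>c\<close> evaluates.\<close>
  have "(1 + q ^ N) * (gauss_prod q N * (B + (- 1) ^ N * q ^ (N * Suc N) * gauss_coeff q N))
     = gauss_prod q n * ((1 - q ^ N) * B + (1 - q ^ N) * ((- 1) ^ N * q ^ N * q ^ (N * N) * gauss_coeff q N))"
    unfolding e mult.assoc[symmetric] mult.commute[of "1 + q ^ N"] p by (simp add: algebra_simps)
  also have "\<dots> = gauss_prod q n * ((1 + q ^ N) * A) + 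
      (1 + q ^ N) * ((- 1) ^ N * q ^ (N * N)) * (gauss_prod q n * gauss_coeff q N * (1 - q ^ N))"
  proof -
    have "(1 - q ^ N) * B = (1 + q ^ N) * A + (- 1) ^ N * q ^ (N * N) * gauss_coeff q N * (1 - q ^ N)"
      using tel by simp
    then show ?thesis by (simp only:) (simp add: algebra_simps)
  qed
  also have "\<dots> = (1 + q ^ N) * (gauss_prod q n * A + 2 * ((- 1) ^ N * q ^ (N * N)))"
    unfolding c by (simp add: algebra_simps)
  finally have "gauss_prod q N * (B + (- 1) ^ N * q ^ (N * Suc N) * gauss_coeff q N)
     = gauss_prod q n * A + 2 * ((- 1) ^ N * q ^ (N * N))"
    using nz by simp
  moreover have "1 + 2 * (\<Sum>k\<in>{1..n}. (- 1) ^ k * q ^ k\<^sup>2) = gauss_prod q n * A"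
    using Suc unfolding A_def N_def by simp
  moreover have "(\<Sum>k\<in>{1..N}. (- 1) ^ k * q ^ k\<^sup>2) =
      (\<Sum>k\<in>{1..n}. (- 1) ^ k * q ^ k\<^sup>2) + (- 1) ^ N * q ^ (N * N)"
    by (simp add: N_def power2_eq_square)
  ultimately show ?case
    unfolding N_def[symmetric] sum.lessThan_Suc B_def[symmetric] by simp
qed

section \<open>Passage to the limit in the finite identity\<close>

lemma gauss_prod_pos:
  assumes "0 < q" "q < 1"
  shows "gauss_prod q n > 0"
  unfolding gauss_prod_def
  using assms by (intro prod_pos ballI divide_pos_pos) (auto intro!: add_pos_pos simp: power_less_one_iff)

lemma gauss_prod_decreasing:
  assumes "0 < q" "q < 1" "m \<le> n"
  shows "gauss_prod q n \<le> gauss_prod q m"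
  using assms(3)
proof (induction rule: dec_induct)
  case (step n)
  have "(1 - q ^ Suc n) / (1 + q ^ Suc n) \<le> 1"
    using assms by (simp add: divide_le_eq_1 add_pos_pos)
  then have "gauss_prod q (Suc n) \<le> gauss_prod q n * 1"
    unfolding gauss_prod_Suc using gauss_prod_pos[OF assms(1,2), of n] by (intro mult_left_mono) auto
  then show ?case using step by simp
qed simp

text \<open>As \<open>gauss_prod q\<close> decreases, the worst case is n = j, where
  \<open>gauss_prod_coeff\<close> gives 2 / (1 + q^j). The bound is uniform in j and n.\<close>

lemma gauss_prod_coeff_bounds:
  assumes "0 < q" "q < 1" "j \<le> n"
  shows "0 \<le> gauss_prod q n * gauss_coeff q j" "gauss_prod q n * gauss_coeff q j \<le> 2"
proof -
  have c0: "gauss_coeff q j \<ge> 0"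
    unfolding gauss_coeff_def using assms(1,2)
    by (intro prod_nonneg ballI divide_nonneg_nonneg) (auto simp: power_le_one simp del: power_Suc)
  then show "0 \<le> gauss_prod q n * gauss_coeff q j"
    using gauss_prod_pos[OF assms(1,2), of n] by simp
  have "gauss_prod q n * gauss_coeff q j \<le> gauss_prod q j * gauss_coeff q j"
    using gauss_prod_decreasing[OF assms] c0 by (rule mult_right_mono)
  also have "\<dots> \<le> 2"
  proof (cases j)
    case 0
    then show ?thesis by (simp add: gauss_prod_def gauss_coeff_def)
  next
    case (Suc i)
    have "gauss_prod q j * gauss_coeff q j = 2 / (1 + q ^ j)"
      using gauss_prod_coeff[OF assms(1,2), of i] by (simp add: Suc gauss_prod_Suc mult.commute mult.left_commute)
    also have "\<dots> \<le> 2"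
      using assms(1,2) by (simp add: divide_le_eq add_pos_pos)
    finally show ?thesis .
  qed
  finally show "gauss_prod q n * gauss_coeff q j \<le> 2" .
qed

text \<open>The unordered sum over the integers is evaluated along the symmetric intervals, on which
  k and -k contribute equally.\<close>

lemma theta4_0_partial_sums:
  fixes q :: real
  assumes "0 < q" "q < 1"
  shows "(\<lambda>n. 1 + 2 * (\<Sum>k\<in>{1..n}. (- 1) ^ k * q ^ k\<^sup>2)) \<longlonglongrightarrow> theta4_0 q"
proof -
  let ?f = "\<lambda>n :: int. (-1) powi n * q powi (n\<^sup>2)"
  have "(?f has_sum theta4_0 q) UNIV"
    unfolding theta4_0_def by (intro has_sum_infsum theta4_0_summable assms)
  moreover have "filterlim (\<lambda>n. {- int n..int n}) (finite_subsets_at_top UNIV) sequentially"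
    unfolding filterlim_finite_subsets_at_top
  proof (intro allI impI)
    fix X :: "int set" assume "finite X \<and> X \<subseteq> UNIV"
    then have fin: "finite X" by simp
    show "\<forall>\<^sub>F n in sequentially. finite {- int n..int n} \<and> X \<subseteq> {- int n..int n} \<and> {- int n..int n} \<subseteq> UNIV"
    \<comment> \<open>Inserting 0 gives \<open>Max\<close> a nonempty set even if \<open>X\<close>
      is empty.\<close>
    proof (rule eventually_sequentiallyI[of "nat (Max (insert 0 (abs ` X)))"])
      fix n assume "nat (Max (insert 0 (abs ` X))) \<le> n"
      then have "Max (insert 0 (abs ` X)) \<le> int n" by simp
      then have "\<forall>x\<in>X. \<bar>x\<bar> \<le> int n" using fin by simp
      then show "finite {- int n..int n} \<and> X \<subseteq> {- int n..int n} \<and> {- int n..int n} \<subseteq> UNIV"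
        by (auto simp: abs_le_iff)
    qed
  qed
  ultimately have lim: "(\<lambda>n. sum ?f {- int n..int n}) \<longlonglongrightarrow> theta4_0 q"
    unfolding has_sum_def by (rule filterlim_compose)
  have "sum ?f {- int n..int n} = 1 + 2 * (\<Sum>k\<in>{1..n}. (- 1) ^ k * q ^ k\<^sup>2)" for n
  proof (induction n)
    case (Suc n)
    have "{- int (Suc n)..int (Suc n)} = insert (- int (Suc n)) (insert (int (Suc n)) {- int n..int n})"
      by auto
    moreover have "?f (- int (Suc n)) = (- 1) ^ Suc n * q ^ (Suc n)\<^sup>2"
    proof -
      have "(- int (Suc n))\<^sup>2 = int ((Suc n)\<^sup>2)" by (simp only: power2_minus of_nat_power)
      then have "q powi ((- int (Suc n))\<^sup>2) = q ^ (Suc n)\<^sup>2" by (metis power_int_of_nat)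
      then show ?thesis by (simp only: power_int_minus power_int_of_nat) (simp flip: power_inverse)
    qed
    moreover have "?f (int (Suc n)) = (- 1) ^ Suc n * q ^ (Suc n)\<^sup>2"
      by (metis of_nat_power power_int_of_nat)
    ultimately show ?case
      using Suc by simp
  qed simp
  then show ?thesis using lim by simp
qed

text \<open>In the finite identity the n terms with j > 0 are each at most 2 q^n in absolute value,
  and n q^n tends to 0.\<close>

lemma gauss_prod_tendsto_theta4_0:
  assumes "0 < q" "q < 1"
  shows "gauss_prod q \<longlonglongrightarrow> theta4_0 q"
proof -
  let ?S = "\<lambda>n. 1 + 2 * (\<Sum>k\<in>{1..n}. (- 1) ^ k * q ^ k\<^sup>2)"
  have bound: "norm (?S n - gauss_prod q n) \<le> 2 * (real n * q ^ n)" for n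
  proof -
    let ?t = "\<lambda>j. (- 1) ^ j * q ^ (j * Suc n) * (gauss_prod q n * gauss_coeff q j)"
    have "?S n = (\<Sum>j<Suc n. ?t j)"
      unfolding gauss_finite_identity[OF assms] sum_distrib_left[of "gauss_prod q n"]
      by (intro sum.cong) (simp_all add: mult_ac)
    also have "\<dots> = gauss_prod q n + (\<Sum>j<n. ?t (Suc j))"
      by (subst sum.lessThan_Suc_shift) (simp add: gauss_coeff_def)
    finally have "norm (?S n - gauss_prod q n) = norm (\<Sum>j<n. ?t (Suc j))" by simp
    also have "\<dots> \<le> (\<Sum>j<n. q ^ n * 2)"
    proof (rule sum_norm_le)
      fix j assume j: "j \<in> {..<n}"
      have "norm (?t (Suc j)) = q ^ (Suc j * Suc n) * (gauss_prod q n * gauss_coeff q (Suc j))"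
        using gauss_prod_coeff_bounds(1)[OF assms, of "Suc j" n] j assms
        unfolding real_norm_def abs_mult[of _ "gauss_prod q n * _"]
        by (simp add: abs_mult[of "(- 1) ^ _"] power_abs del: mult_Suc mult_Suc_right power_Suc)
      also have "\<dots> \<le> q ^ n * 2"
        using gauss_prod_coeff_bounds[OF assms, of "Suc j" n] j assms
        by (intro mult_mono power_decreasing) auto
      finally show "norm (?t (Suc j)) \<le> q ^ n * 2" .
    qed
    finally show ?thesis by (simp add: mult_ac)
  qed
  have "(\<lambda>n. 2 * (real n * q ^ n)) \<longlonglongrightarrow> 0"
    using assms by (intro tendsto_mult_right_zero powser_times_n_limit_0) auto
  then have "(\<lambda>n. ?S n - gauss_prod q n) \<longlonglongrightarrow> 0"
    by (rule Lim_null_comparison[OF always_eventually[OF allI[OF bound]]])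
  from tendsto_diff[OF theta4_0_partial_sums[OF assms] this] show ?thesis by simp
qed

section \<open>Generating functions of multisets with prescribed multiplicities\<close>

text \<open>The condition on multiplicities is uniform in the part: \<open>m p\<close> divides the multiplicity
  of \<open>p\<close>. Even multiplicities of odd parts correspond to \<open>m p = 2\<close> for odd and \<open>m p = 1\<close> for even \<open>p\<close>.\<close>

definition multisets_with :: "(nat \<Rightarrow> nat) \<Rightarrow> nat set \<Rightarrow> nat multiset set" where
  "multisets_with m S = {P. set_mset P \<subseteq> S \<and> (\<forall>p. m p dvd count P p)}"

text \<open>A multiset over \<open>insert p S\<close> is a pair of a number j, with
  \<open>m p * j\<close> copies of \<open>p\<close>, and a multiset over \<open>S\<close>; summing
  over j gives the geometric series of the new factor.\<close>

lemma has_sum_multisets_with_finite: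
  fixes y :: real
  assumes "finite S" "0 \<notin> S" "\<And>p. m p > 0" "0 < y" "y < 1"
  shows "((\<lambda>P. y ^ sum_mset P) has_sum (\<Prod>p\<in>S. 1 / (1 - y ^ (m p * p)))) (multisets_with m S)"
  using assms(1,2)
proof (induction S rule: finite_induct)
  case empty
  have "multisets_with m {} = {{#}}" by (auto simp: multisets_with_def)
  then show ?case using has_sum_finite[of "{{#}}" "\<lambda>P. y ^ sum_mset P"] by simp
next
  case (insert p S)
  let ?C = "\<Prod>p\<in>S. 1 / (1 - y ^ (m p * p))"
  let ?f = "\<lambda>(j, Q). (y ^ (m p * p)) ^ j * y ^ sum_mset Q"
  have y: "0 < y ^ (m p * p)" "y ^ (m p * p) < 1"
    using assms(3)[of p] insert.prems assms(4,5) by (auto simp: power_less_one_iff)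
  have IH: "((\<lambda>P. y ^ sum_mset P) has_sum ?C) (multisets_with m S)"
    using insert by auto
  have geo: "((\<lambda>j. (y ^ (m p * p)) ^ j) has_sum (1 / (1 - y ^ (m p * p)))) UNIV"
    using y by (intro sums_nonneg_imp_has_sum geometric_sums) auto
  have inner: "((\<lambda>Q. ?f (j, Q)) has_sum ((y ^ (m p * p)) ^ j * ?C)) (multisets_with m S)" for j
    using has_sum_cmult_right[OF IH, of "(y ^ (m p * p)) ^ j"] by simp
  have outer: "((\<lambda>j. (y ^ (m p * p)) ^ j * ?C) has_sum (1 / (1 - y ^ (m p * p)) * ?C)) UNIV"
    by (rule has_sum_cmult_left[OF geo])
  have "(?f has_sum (1 / (1 - y ^ (m p * p)) * ?C)) (Sigma UNIV (\<lambda>_. multisets_with m S))"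
  proof (rule has_sum_SigmaI[OF inner outer])
    show "?f summable_on Sigma UNIV (\<lambda>_. multisets_with m S)"
      by (rule summable_on_SigmaI[OF inner])
         (use outer assms in \<open>auto simp: summable_on_def\<close>)
  qed
  also have "?this \<longleftrightarrow> ((\<lambda>P. y ^ sum_mset P) has_sum (1 / (1 - y ^ (m p * p)) * ?C)) (multisets_with m (insert p S))"
  proof (rule has_sum_reindex_bij_witness[where
        i = "\<lambda>P. (count P p div m p, filter_mset (\<lambda>r. r \<noteq> p) P)" and
        j = "\<lambda>(j, Q). replicate_mset (m p * j) p + Q"], goal_cases)
    case (1 a)
    then obtain j Q where a: "a = (j, Q)" "Q \<in> multisets_with m S" by auto
    have "p \<notin># Q" using a insert.hyps by (auto simp: multisets_with_def)
    then have "count Q p = 0" "filter_mset (\<lambda>r. r \<noteq> p) Q = Q"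
      by (auto simp: count_eq_zero_iff filter_mset_eq_conv)
    then show ?case using a assms(3)[of p] by simp
  next
    case (2 a)
    then show ?case by (auto simp: multisets_with_def split: if_splits)
  next
    case (3 P)
    then have "m p dvd count P p" by (auto simp: multisets_with_def)
    then show ?case
      by (auto intro!: multiset_eqI)
  next
    case (4 P)
    then show ?case by (auto simp: multisets_with_def)
  next
    case (5 a)
    then show ?case by (auto simp: power_add power_mult mult_ac simp flip: power_mult)
  qed simp
  finally show ?case using insert by simp
qed

text \<open>A finite family of multisets involves finitely many parts, so it already lives over some
  \<open>T n\<close>. With nonnegative terms this bounds the sum by L from above, and the partial
  products bound it from below. The free choice of \<open>T\<close> admits cutoffs such as
  6n.\<close>

lemma has_sum_multisets_with:
  fixes y :: real
  assumes T: "incseq T" "\<And>n. finite (T n)" and "0 \<notin> (\<Union>n. T n)" "\<And>p. m p > 0" "0 < y" "y < 1"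
    and lim: "(\<lambda>n. \<Prod>p\<in>T n. 1 / (1 - y ^ (m p * p))) \<longlonglongrightarrow> L"
  shows "((\<lambda>P. y ^ sum_mset P) has_sum L) (multisets_with m (\<Union>n. T n))"
proof -
  let ?S = "\<Union>n. T n" and ?f = "\<lambda>P. y ^ sum_mset P"
  let ?p = "\<lambda>n. \<Prod>p\<in>T n. 1 / (1 - y ^ (m p * p))"
  have part: "(?f has_sum ?p n) (multisets_with m (T n))" for n
    using assms by (intro has_sum_multisets_with_finite) auto
  have "incseq ?p"
  proof (rule incseq_SucI)
    fix n
    have "multisets_with m (T n) \<subseteq> multisets_with m (T (Suc n))"
      using incseq_SucD[OF T(1), of n] by (auto simp: multisets_with_def)
    then show "?p n \<le> ?p (Suc n)"
      using assms by (intro has_sum_mono2[OF part part]) auto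
  qed
  then have le: "?p n \<le> L" for n using lim by (rule incseq_le)
  have bound: "sum ?f F \<le> L" if F: "finite F" "F \<subseteq> multisets_with m ?S" for F
  proof -
    have "finite (\<Union>P\<in>F. set_mset P)" "(\<Union>P\<in>F. set_mset P) \<subseteq> ?S"
      using F by (auto simp: multisets_with_def)
    moreover have "range T \<noteq> {}" by simp
    moreover have "subset.chain UNIV (range T)"
      using incseqD[OF T(1)] nat_le_linear unfolding subset_chain_def by blast
    ultimately obtain n where n: "(\<Union>P\<in>F. set_mset P) \<subseteq> T n"
      by (rule finite_subset_Union_chain) blast
    then have "F \<subseteq> multisets_with m (T n)" using F by (auto simp: multisets_with_def)
    then have "sum ?f F \<le> ?p n"
      using F assms by (intro finite_sum_le_has_sum[OF part]) auto
    then show ?thesis using le[of n] by simp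
  qed
  then have sm: "?f summable_on multisets_with m ?S"
    using assms by (intro nonneg_bounded_partial_sums_imp_summable_on[where C = L])
       (auto intro!: eventually_finite_subsets_at_top_weakI)
  have "infsum ?f (multisets_with m ?S) \<le> L"
    using sm bound by (rule infsum_le_finite_sums)
  moreover have "?p n \<le> infsum ?f (multisets_with m ?S)" for n
    using assms by (intro has_sum_mono2[OF part has_sum_infsum[OF sm]]) (auto simp: multisets_with_def)
  then have "L \<le> infsum ?f (multisets_with m ?S)"
    using lim by (intro LIMSEQ_le_const2) auto
  ultimately have "infsum ?f (multisets_with m ?S) = L" by (rule antisym)
  then show ?thesis using has_sum_infsum[OF sm] by metis
qed

section \<open>Euler products over selected exponents\<close>

definition euler_prod :: "(nat \<Rightarrow> bool) \<Rightarrow> real \<Rightarrow> nat \<Rightarrow> real" where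
  "euler_prod R q n = (\<Prod>k\<in>{k\<in>{1..n}. R k}. 1 - q ^ k)"

lemma euler_prod_nonzero:
  assumes "0 < q" "q < 1"
  shows "euler_prod R q n \<noteq> 0"
proof -
  have "1 - q ^ k \<noteq> 0" if "k \<ge> 1" for k
    using power_Suc_less_one[OF assms, of "k - 1"] that by simp
  then show ?thesis unfolding euler_prod_def by simp
qed

text \<open>Setting the factors outside \<open>R\<close> to 1 gives an absolutely convergent product
  of nonzero factors, so its limit may later appear in denominators.\<close>

lemma euler_prod_tendsto:
  assumes "0 < q" "q < 1"
  obtains l where "l \<noteq> 0" "euler_prod R q \<longlonglongrightarrow> l"
proof -
  define f where "f k = (if R (Suc k) then 1 - q ^ Suc k else 1)" for k
  have nz: "f k \<noteq> 0" for k
    using power_Suc_less_one[OF assms, of k] by (auto simp: f_def)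
  have "summable (\<lambda>k. q * q ^ k)"
    using assms by (intro summable_mult summable_geometric) auto
  then have "summable (\<lambda>k. norm (f k - 1))"
    by (rule summable_comparison_test'[where N = 0]) (use assms in \<open>auto simp: f_def\<close>)
  then have conv: "convergent_prod f"
    by (intro abs_convergent_prod_imp_convergent_prod summable_imp_abs_convergent_prod)
  have "(\<Prod>i<n. f i) = euler_prod R q n" for n
  proof -
    have "(\<Prod>i<n. f i) = (\<Prod>k\<in>{1..n}. if R k then 1 - q ^ k else 1)"
      unfolding f_def by (rule prod.reindex_bij_witness[of _ "\<lambda>k. k - 1" Suc]) auto
    also have "\<dots> = euler_prod R q n"
      unfolding euler_prod_def by (rule prod.inter_filter[symmetric]) simp
    finally show ?thesis .
  qed
  then have "euler_prod R q \<longlonglongrightarrow> prodinf f"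
    using convergent_prod_LIMSEQ[OF conv] by (simp flip: LIMSEQ_lessThan_iff_atMost)
  with prodinf_nonzero[OF conv nz] show thesis by (rule that)
qed

text \<open>Each factor is (1 - t) / (1 + t) = (1 - t)^2 / (1 - t^2) with t = q^k.\<close>

lemma prod_gauss_factors_eq_euler_prod:
  assumes "0 < q" "q < 1"
  shows "(\<Prod>k\<in>{k\<in>{1..n}. R k}. (1 - q ^ k) / (1 + q ^ k)) = (euler_prod R q n)\<^sup>2 / euler_prod R (q\<^sup>2) n"
proof -
  have "(1 - q ^ k) / (1 + q ^ k) = (1 - q ^ k)\<^sup>2 / (1 - (q\<^sup>2) ^ k)" if "k \<ge> 1" for k
  proof -
    have "q ^ k < 1" "q ^ k > 0" using assms that by (auto simp: power_less_one_iff)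
    moreover have "1 - (q\<^sup>2) ^ k = (1 - q ^ k) * (1 + q ^ k)"
      by (simp add: power_commutes power2_eq_square power_mult_distrib algebra_simps)
    ultimately show ?thesis by (simp add: power2_eq_square)
  qed
  then show ?thesis
    unfolding euler_prod_def prod_power_distrib prod_dividef[symmetric] by (intro prod.cong) auto
qed

text \<open>Positive partial products could still tend to 0; written through Euler products, whose
  limits are nonzero, they cannot.\<close>

lemma theta4_0_nonzero:
  assumes "0 < q" "q < 1"
  shows "theta4_0 q \<noteq> 0"
proof -
  have q2: "0 < q\<^sup>2" "q\<^sup>2 < 1" using assms by (auto simp: power_less_one_iff)
  obtain l1 where l1: "l1 \<noteq> 0" "euler_prod (\<lambda>_. True) q \<longlonglongrightarrow> l1"
    using euler_prod_tendsto[OF assms] .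
  obtain l2 where l2: "l2 \<noteq> 0" "euler_prod (\<lambda>_. True) (q\<^sup>2) \<longlonglongrightarrow> l2"
    using euler_prod_tendsto[OF q2] .
  have "gauss_prod q = (\<lambda>n. (euler_prod (\<lambda>_. True) q n)\<^sup>2 / euler_prod (\<lambda>_. True) (q\<^sup>2) n)"
    unfolding prod_gauss_factors_eq_euler_prod[OF assms, symmetric] by (intro ext) (auto simp: gauss_prod_def intro!: prod.cong)
  then have "gauss_prod q \<longlonglongrightarrow> l1\<^sup>2 / l2"
    using l1 l2 by (auto intro!: tendsto_intros)
  then have "theta4_0 q = l1\<^sup>2 / l2"
    using gauss_prod_tendsto_theta4_0[OF assms] LIMSEQ_unique by blast
  then show ?thesis using l1 l2 by simp
qed

text \<open>The cutoff 3n makes the factors with 3 dividing k cancel exactly against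
  \<open>gauss_prod (q ^ 3) n\<close>.\<close>

lemma gauss_ratio_eq_euler_prod:
  assumes "0 < q" "q < 1"
  shows "gauss_prod (q ^ 3) n / gauss_prod q (3 * n) =
    euler_prod (\<lambda>k. \<not> 3 dvd k) (q\<^sup>2) (3 * n) / (euler_prod (\<lambda>k. \<not> 3 dvd k) q (3 * n))\<^sup>2"
proof -
  let ?g = "\<lambda>k. (1 - q ^ k) / (1 + q ^ k)"
  have q3: "0 < q ^ 3" "q ^ 3 < 1" using assms by (auto simp: power_less_one_iff)
  have "prod ?g {k\<in>{1..3 * n}. 3 dvd k} = gauss_prod (q ^ 3) n"
    unfolding gauss_prod_def
    by (rule prod.reindex_bij_witness[of _ "\<lambda>k. 3 * k" "\<lambda>k. k div 3"])
       (auto simp: elim!: dvdE simp flip: power_mult)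
  moreover have "gauss_prod q (3 * n) =
      prod ?g {k\<in>{1..3 * n}. 3 dvd k} * prod ?g {k\<in>{1..3 * n}. \<not> 3 dvd k}"
    unfolding gauss_prod_def by (subst prod.union_disjoint[symmetric]) (auto intro!: prod.cong)
  ultimately show ?thesis
    using gauss_prod_pos[OF q3, of n] unfolding prod_gauss_factors_eq_euler_prod[OF assms] by simp
qed

text \<open>An even part 2k gives 1 - x^k with k up to 3n, an odd part p gives 1 - x^p. As in
  Euler's theorem, the product over odd p is the full product up to 6n divided by its even part, a
  product in x^2 up to 3n.\<close>

lemma prod_even_odd_weights_eq_euler_prod:
  assumes "0 < x" "x < 1"
  shows "(\<Prod>p\<in>{p\<in>{1..6 * n}. \<not> 3 dvd p}. 1 / (1 - sqrt x ^ ((if odd p then 2 else 1) * p))) =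
    euler_prod (\<lambda>k. \<not> 3 dvd k) (x\<^sup>2) (3 * n) /
    (euler_prod (\<lambda>k. \<not> 3 dvd k) x (3 * n) * euler_prod (\<lambda>k. \<not> 3 dvd k) x (6 * n))"
proof -
  let ?T = "{p\<in>{1..6 * n}. \<not> 3 dvd p}" and ?Q = "euler_prod (\<lambda>k. \<not> 3 dvd k)"
  let ?w = "\<lambda>p. 1 - sqrt x ^ ((if odd p then 2 else 1) * p)"
  have split: "prod f ?T = prod f {p\<in>?T. even p} * prod f {p\<in>?T. odd p}" for f :: "nat \<Rightarrow> real"
    by (subst prod.union_disjoint[symmetric]) (auto intro!: prod.cong)
  have evens: "prod f {p\<in>?T. even p} = (\<Prod>k\<in>{k\<in>{1..3 * n}. \<not> 3 dvd k}. f (2 * k))"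
    for f :: "nat \<Rightarrow> real"
  proof (rule prod.reindex_bij_witness[of _ "\<lambda>k. 2 * k" "\<lambda>k. k div 2"], goal_cases)
    case (5 p)
    then show ?case by auto
  next
    case (4 k)
    then show ?case by auto presburger
  next
    case (3 p)
    then show ?case by auto
  next
    case (2 p)
    then show ?case by (auto elim!: evenE)
  qed auto
  have "prod ?w ?T = ?Q x (3 * n) * (\<Prod>p\<in>{p\<in>?T. odd p}. 1 - x ^ p)"
    unfolding split evens using assms by (simp add: euler_prod_def power_mult)
  moreover have "?Q x (6 * n) = ?Q (x\<^sup>2) (3 * n) * (\<Prod>p\<in>{p\<in>?T. odd p}. 1 - x ^ p)"
    unfolding euler_prod_def split evens by (simp add: power_mult)
  moreover have "?Q x (6 * n) \<noteq> 0" "?Q (x\<^sup>2) (3 * n) \<noteq> 0" "?Q x (3 * n) \<noteq> 0"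
    using assms by (intro euler_prod_nonzero; simp add: power_less_one_iff)+
  ultimately show ?thesis
    by (simp add: prod_dividef)
qed

section \<open>The generating function of \<open>a_count\<close>\<close>

lemma sum_mset_eq_sum_count:
  fixes P :: "'a :: comm_semiring_1 multiset"
  assumes "finite A" "set_mset P \<subseteq> A"
  shows "sum_mset P = (\<Sum>p\<in>A. of_nat (count P p) * p)"
  using assms(2)
proof (induction P)
  case (add q P)
  have "(\<Sum>p\<in>A. of_nat (count (add_mset q P) p) * p) =
      (\<Sum>p\<in>A. (if q = p then p else 0) + of_nat (count P p) * p)"
    by (intro sum.cong) (auto simp: distrib_right)
  then show ?case using add assms(1) by (simp add: sum.distrib)
qed simp

text \<open>The theta quotient and the sum over all admissible multisets are both l2 / l1^2;
  grouping that sum by half the size of the partition gives the power series.\<close>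

lemma a_count_generating_function:
  assumes x: "0 < x" "x < 1"
  shows "(\<lambda>n. real (a_count n) * x ^ n) sums (theta4_0 (x ^ 3) / theta4_0 x)"
proof -
  let ?Q = "euler_prod (\<lambda>k. \<not> 3 dvd k)" and ?L = "theta4_0 (x ^ 3) / theta4_0 x"
  let ?T = "\<lambda>n. {p\<in>{1..6 * n}. \<not> 3 dvd (p :: nat)}" and ?m = "\<lambda>p :: nat. if odd p then 2 else 1 :: nat"
  let ?A = "multisets_with ?m {p. \<not> 3 dvd p}"
  define B where "B n = {P \<in> partitions (2 * n).
     (\<forall>p\<in>#P. \<not> 3 dvd p) \<and> (\<forall>p. odd p \<longrightarrow> even (count P p))}" for n
  have x2: "0 < x\<^sup>2" "x\<^sup>2 < 1" and x3: "0 < x ^ 3" "x ^ 3 < 1"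
    using x by (auto simp: power_less_one_iff)
  have sub: "strict_mono (\<lambda>n :: nat. 3 * n)" "strict_mono (\<lambda>n :: nat. 6 * n)"
    by (auto intro: strict_monoI)
  obtain l1 where l1: "l1 \<noteq> 0" "?Q x \<longlonglongrightarrow> l1"
    using euler_prod_tendsto[OF x] .
  obtain l2 where l2: "l2 \<noteq> 0" "?Q (x\<^sup>2) \<longlonglongrightarrow> l2"
    using euler_prod_tendsto[OF x2] .
  \<comment> \<open>The two finite products have different cutoffs, 3n twice against 3n and 6n, so
    they are compared only through the common limit l1.\<close>
  have lims: "(\<lambda>n. ?Q x (3 * n)) \<longlonglongrightarrow> l1" "(\<lambda>n. ?Q x (6 * n)) \<longlonglongrightarrow> l1"
      "(\<lambda>n. ?Q (x\<^sup>2) (3 * n)) \<longlonglongrightarrow> l2"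
    using l1 l2 LIMSEQ_subseq_LIMSEQ[OF _ sub(1)] LIMSEQ_subseq_LIMSEQ[OF _ sub(2)]
    by (auto simp: o_def)
  have "(\<lambda>n. gauss_prod (x ^ 3) n / gauss_prod x (3 * n)) \<longlonglongrightarrow> ?L"
    using gauss_prod_tendsto_theta4_0[OF x3] theta4_0_nonzero[OF x]
      LIMSEQ_subseq_LIMSEQ[OF gauss_prod_tendsto_theta4_0[OF x] sub(1)]
    by (intro tendsto_divide) (auto simp: o_def)
  moreover have "(\<lambda>n. gauss_prod (x ^ 3) n / gauss_prod x (3 * n)) \<longlonglongrightarrow> l2 / l1\<^sup>2"
    unfolding gauss_ratio_eq_euler_prod[OF x] using l1 lims by (intro tendsto_intros) auto
  ultimately have "?L = l2 / (l1 * l1)"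
    unfolding power2_eq_square by (rule LIMSEQ_unique)
  moreover have "(\<lambda>n. \<Prod>p\<in>?T n. 1 / (1 - sqrt x ^ (?m p * p))) \<longlonglongrightarrow> l2 / (l1 * l1)"
    unfolding prod_even_odd_weights_eq_euler_prod[OF x] using l1 lims by (intro tendsto_intros) auto
  ultimately have "((\<lambda>P. sqrt x ^ sum_mset P) has_sum ?L) (multisets_with ?m (\<Union>n. ?T n))"
    using x by (intro has_sum_multisets_with) (auto simp: incseq_def)
  also have "(\<Union>n. ?T n) = {p. \<not> 3 dvd p}"
  proof (intro equalityI subsetI)
    fix p :: nat assume "p \<in> {p. \<not> 3 dvd p}"
    then have "p \<in> ?T p" by (cases p) auto
    then show "p \<in> (\<Union>n. ?T n)" by blast
  qed auto
  finally have sum_A: "((\<lambda>P. sqrt x ^ sum_mset P) has_sum ?L) ?A" .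
  \<comment> \<open>Parts of a multiset in \<open>?A\<close> are positive because
    \<open>3 dvd 0\<close>.\<close>
  have memB: "P \<in> B n \<longleftrightarrow> P \<in> ?A \<and> sum_mset P = 2 * n" for P n
    by (auto simp: B_def partitions_def multisets_with_def intro!: Nat.gr0I)
  have even_sum: "even (sum_mset P)" if "P \<in> ?A" for P
  proof -
    have "sum_mset P = (\<Sum>p\<in>set_mset P. count P p * p)"
      using sum_mset_eq_sum_count[of "set_mset P" P] by simp
    also have "even \<dots>"
      using that by (intro dvd_sum) (auto simp: multisets_with_def split: if_splits)
    finally show ?thesis .
  qed
  \<comment> \<open>Halving loses nothing: by \<open>even_sum\<close> every \<open>P\<close> in
    \<open>?A\<close> lies in exactly one fibre \<open>B n\<close>.\<close>
  have "((\<lambda>(n, P). sqrt x ^ sum_mset P) has_sum ?L) (Sigma UNIV B)"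
    using sum_A
    by (rule has_sum_reindex_bij_witness[where i = "\<lambda>P. (sum_mset P div 2, P)" and j = snd, THEN iffD2, rotated -1])
       (auto simp: memB even_sum)
  then have "((\<lambda>n. real (a_count n) * x ^ n) has_sum ?L) UNIV"
  proof (rule has_sum_Sigma')
    fix n
    have fin: "finite (B n)"
      unfolding B_def using finite_partitions by (rule finite_subset[rotated]) blast
    have "(\<Sum>P\<in>B n. sqrt x ^ sum_mset P) = (\<Sum>P\<in>B n. x ^ n)"
      using x by (intro sum.cong) (auto simp: memB power_mult)
    also have "\<dots> = real (a_count n) * x ^ n"
      by (simp add: a_count_def B_def)
    finally show "((\<lambda>P. case (n, P) of (n, P) \<Rightarrow> sqrt x ^ sum_mset P) has_sum (real (a_count n) * x ^ n)) (B n)"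
      using has_sum_finite[OF fin, of "\<lambda>P. sqrt x ^ sum_mset P"] by simp
  qed
  then show ?thesis by (rule has_sum_imp_sums)
qed

theorem mainTheorem5:
  fixes x :: real
  assumes "0 < x" and "x < 1"
  shows "Z3 x / Delta3 x = theta4_0 (x ^ 3) / theta4_0 x \<and>
         (\<lambda>n. real (a_count n) * x ^ n) sums (theta4_0 (x ^ 3) / theta4_0 x)"
proof
  have x3: "0 < x ^ 3" "x ^ 3 < 1" using assms by (auto simp: power_less_one_iff)
  have factor: "(1 + t + t\<^sup>2) / (1 - t + t\<^sup>2) = ((1 - t ^ 3) / (1 + t ^ 3)) / ((1 - t) / (1 + t))"
    if "0 < t" "t < 1" for t :: real
  proof -
    have "1 - t ^ 3 = (1 - t) * (1 + t + t\<^sup>2)" "1 + t ^ 3 = (1 + t) * (1 - t + t\<^sup>2)"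
      by (simp_all add: power2_eq_square power3_eq_cube algebra_simps)
    then show ?thesis using that by simp
  qed
  \<comment> \<open>The infinite products start at index 0 and \<open>gauss_prod\<close> at 1, so
    the factors up to index n match \<open>Suc n\<close>.\<close>
  have "(\<Prod>k\<le>n. 1 + x ^ Suc k + x ^ (2 * Suc k)) / (\<Prod>k\<le>n. 1 - x ^ Suc k + x ^ (2 * Suc k)) =
      gauss_prod (x ^ 3) (Suc n) / gauss_prod x (Suc n)" for n
  proof -
    have "(1 + x ^ Suc k + x ^ (2 * Suc k)) / (1 - x ^ Suc k + x ^ (2 * Suc k)) =
        ((1 - (x ^ 3) ^ Suc k) / (1 + (x ^ 3) ^ Suc k)) / ((1 - x ^ Suc k) / (1 + x ^ Suc k))" for k
    proof -
      have "x ^ (2 * Suc k) = (x ^ Suc k)\<^sup>2" "(x ^ 3) ^ Suc k = (x ^ Suc k) ^ 3"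
        by (metis power_mult mult.commute)+
      moreover have "0 < x ^ Suc k" "x ^ Suc k < 1"
        using assms power_Suc_less_one by auto
      ultimately show ?thesis using factor[of "x ^ Suc k"] by metis
    qed
    moreover have "gauss_prod q (Suc n) = (\<Prod>k\<le>n. (1 - q ^ Suc k) / (1 + q ^ Suc k))" for q
      unfolding gauss_prod_def
      by (rule prod.reindex_bij_witness[of _ Suc "\<lambda>k. k - 1"]) auto
    ultimately show ?thesis by (simp only: prod_dividef[symmetric])
  qed
  moreover have "(\<lambda>n. (\<Prod>k\<le>n. 1 + x ^ Suc k + x ^ (2 * Suc k)) /
      (\<Prod>k\<le>n. 1 - x ^ Suc k + x ^ (2 * Suc k))) \<longlonglongrightarrow> Z3 x / Delta3 x"
    using convergent_prod_LIMSEQ[OF Z3_convergent[OF assms]]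
      convergent_prod_LIMSEQ[OF Delta3_convergent[OF assms]] Delta3_nonzero[OF assms]
    unfolding Z3_def Delta3_def by (rule tendsto_divide)
  ultimately have "(\<lambda>n. gauss_prod (x ^ 3) (Suc n) / gauss_prod x (Suc n)) \<longlonglongrightarrow> Z3 x / Delta3 x"
    by simp
  moreover have "(\<lambda>n. gauss_prod (x ^ 3) (Suc n) / gauss_prod x (Suc n)) \<longlonglongrightarrow>
      theta4_0 (x ^ 3) / theta4_0 x"
    by (intro tendsto_divide LIMSEQ_Suc gauss_prod_tendsto_theta4_0 theta4_0_nonzero assms x3)
  ultimately show "Z3 x / Delta3 x = theta4_0 (x ^ 3) / theta4_0 x"
    by (rule LIMSEQ_unique)
  show "(\<lambda>n. real (a_count n) * x ^ n) sums (theta4_0 (x ^ 3) / theta4_0 x)"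
    using a_count_generating_function[OF assms] .
qed

end
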